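(* Let $\{\omega_m\}_{m=1}^\infty$ be a sequence of positive numbers ($\omega_m>0$ for every $m$). Then there exists an isometric embedding $F:[0,1]\to L_1[0,1]$, $t\mapsto F_t$, such that: (A) For each $t\in[0,1]$ the function $F_t(x)$ is infinitely differentiable on $[0,1]$ with bounds $\max_{x\in[0,1]}\left|F_t^{(m)}(x)\right|\le \omega_m$ for all $m\in\mathbb{N}=\{1,2,\dots\}$, and has an analytic extension to the complex plane which is an entire function. (B) The map $t\mapsto F_t$ does not have points of differentiability in $[0,1]$.
   Context: $L_1[0,1]$ is the Banach space of (classes of) Lebesgue integrable functions on $[0,1]$ with norm $\|f\|_{L_1}=\int_0^1|f(x)|\,dx$. For a map $F:[0,1]\to L_1[0,1]$, the element of $L_1[0,1]$ corresponding to $t\in[0,1]$ is denoted $F_t$, and $F_t(x)$ denotes its value at $x\in[0,1]$; saying that $F_t$ has the properties in (A) means that the class $F_t$ has a representative, a function of $x\in[0,1]$, with these properties, and $F_t^{(m)}$ is the $m$-th derivative in $x$ of this representative. An isometric embedding is a distance-preserving map: $\|F_t-F_s\|_{L_1}=|t-s|$ for all $s,t\in[0,1]$ (no linearity is involved). The map $F$ is differentiable at $t_0\in[0,1]$ if there is $D\in L_1[0,1]$ such that $\|F_{t_0+h}-F_{t_0}-hD\|_{L_1}=o(h)$ as $|h|\downarrow 0$ with $t_0+h\in[0,1]$ (so at the endpoints $0$ and $1$ differentiability is one-sided); such a $t_0$ is called a point of differentiability of $F$. *)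

theory Defs
  imports "HOL-Analysis.Analysis"
begin

abbreviation unit_leb :: "real measure" where
  "unit_leb \<equiv> lebesgue_on {0..1}"

definition L1_rel :: "(real \<Rightarrow> real) \<Rightarrow> (real \<Rightarrow> real) \<Rightarrow> bool" where
  "L1_rel f g \<longleftrightarrow> integrable unit_leb f \<and> integrable unit_leb g \<and> (AE x in unit_leb. f x = g x)"

lemma part_equivp_L1_rel: "part_equivp L1_rel"
proof (rule part_equivpI)
  show "\<exists>f. L1_rel f f"
    by (rule exI[of _ "\<lambda>_. 0"]) (simp add: L1_rel_def)
  show "symp L1_rel"
    by (auto simp: symp_def L1_rel_def eq_commute)
  show "transp L1_rel"
    unfolding transp_def L1_rel_def by (auto elim: AE_mp)
qed

text \<open>
  The space \<open>L\<^sub>1[0,1]\<close>. Representatives are total functions on the reals,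
  but \<^const>\<open>L1_rel\<close> ignores their values outside \<open>[0,1]\<close>.
\<close>

quotient_type L1 = "real \<Rightarrow> real" / partial: L1_rel
  by (rule part_equivp_L1_rel)

definition represents :: "(real \<Rightarrow> real) \<Rightarrow> L1 \<Rightarrow> bool" where
  "represents f u \<longleftrightarrow> integrable unit_leb f \<and> abs_L1 f = u"

instantiation L1 :: real_normed_vector
begin

lift_definition zero_L1 :: L1 is "\<lambda>_. 0"
  by (simp add: L1_rel_def)

lift_definition plus_L1 :: "L1 \<Rightarrow> L1 \<Rightarrow> L1" is "\<lambda>f g x. f x + g x"
  unfolding L1_rel_def by (auto elim: AE_mp)

lift_definition minus_L1 :: "L1 \<Rightarrow> L1 \<Rightarrow> L1" is "\<lambda>f g x. f x - g x"
  unfolding L1_rel_def by (auto elim: AE_mp)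

lift_definition uminus_L1 :: "L1 \<Rightarrow> L1" is "\<lambda>f x. - f x"
  unfolding L1_rel_def by (auto elim: AE_mp)

lift_definition scaleR_L1 :: "real \<Rightarrow> L1 \<Rightarrow> L1" is "\<lambda>c f x. c * f x"
  unfolding L1_rel_def by (auto elim: AE_mp)

lift_definition norm_L1 :: "L1 \<Rightarrow> real" is "\<lambda>f. LINT x|unit_leb. \<bar>f x\<bar>"
  unfolding L1_rel_def by (intro integral_cong_AE) (auto elim: AE_mp)

definition dist_L1 :: "L1 \<Rightarrow> L1 \<Rightarrow> real" where
  "dist_L1 u v = norm (u - v)"

definition sgn_L1 :: "L1 \<Rightarrow> L1" where
  "sgn_L1 u = inverse (norm u) *\<^sub>R u"

definition uniformity_L1 :: "(L1 \<times> L1) filter" where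
  "uniformity_L1 = (INF e\<in>{0<..}. principal {(u, v). dist u v < e})"

definition open_L1 :: "L1 set \<Rightarrow> bool" where
  "open_L1 U \<longleftrightarrow> (\<forall>u\<in>U. \<forall>\<^sub>F (u', v) in uniformity. u' = u \<longrightarrow> v \<in> U)"

instance
proof
  fix a b c :: L1 and r s :: real
  show "a + b + c = a + (b + c)"
    by transfer (auto simp: L1_rel_def algebra_simps)
  show "a + b = b + a"
    by transfer (auto simp: L1_rel_def algebra_simps)
  show "0 + a = a"
    by transfer (auto simp: L1_rel_def)
  show "- a + a = 0"
    by transfer (auto simp: L1_rel_def)
  show "a - b = a + - b"
    by transfer (auto simp: L1_rel_def)
  show "r *\<^sub>R (a + b) = r *\<^sub>R a + r *\<^sub>R b"
    by transfer (auto simp: L1_rel_def algebra_simps)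
  show "(r + s) *\<^sub>R a = r *\<^sub>R a + s *\<^sub>R a"
    by transfer (auto simp: L1_rel_def algebra_simps)
  show "r *\<^sub>R s *\<^sub>R a = (r * s) *\<^sub>R a"
    by transfer (auto simp: L1_rel_def algebra_simps)
  show "1 *\<^sub>R a = a"
    by transfer (auto simp: L1_rel_def)
  show "dist a b = norm (a - b)"
    by (rule dist_L1_def)
  show "sgn a = inverse (norm a) *\<^sub>R a"
    by (rule sgn_L1_def)
  show "norm a = 0 \<longleftrightarrow> a = 0"
    by transfer (simp add: L1_rel_def integral_nonneg_eq_0_iff_AE)
  show "norm (a + b) \<le> norm a + norm b"
  proof transfer
    fix f g :: "real \<Rightarrow> real"
    assume "L1_rel f f" "L1_rel g g"
    then have i: "integrable unit_leb f" "integrable unit_leb g"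
      by (auto simp: L1_rel_def)
    have "(LINT x|unit_leb. \<bar>f x + g x\<bar>) \<le> (LINT x|unit_leb. \<bar>f x\<bar> + \<bar>g x\<bar>)"
      using i by (intro integral_mono) auto
    also have "\<dots> = (LINT x|unit_leb. \<bar>f x\<bar>) + (LINT x|unit_leb. \<bar>g x\<bar>)"
      using i by (intro Bochner_Integration.integral_add) auto
    finally show "(LINT x|unit_leb. \<bar>f x + g x\<bar>) \<le> (LINT x|unit_leb. \<bar>f x\<bar>) + (LINT x|unit_leb. \<bar>g x\<bar>)" .
  qed
  show "norm (r *\<^sub>R a) = \<bar>r\<bar> * norm a"
    by transfer (simp add: abs_mult)
qed (rule uniformity_L1_def open_L1_def)+

end

text \<open>Derivatives are taken within \<open>[0,1]\<close>, hence one-sided at the endpoints.\<close>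

primrec unit_deriv :: "nat \<Rightarrow> (real \<Rightarrow> real) \<Rightarrow> real \<Rightarrow> real" where
  "unit_deriv 0 f = f"
| "unit_deriv (Suc m) f = (\<lambda>x. vector_derivative (unit_deriv m f) (at x within {0..1}))"

definition smooth_on_unit :: "(real \<Rightarrow> real) \<Rightarrow> bool" where
  "smooth_on_unit f \<longleftrightarrow> (\<forall>m. unit_deriv m f differentiable_on {0..1})"

definition has_entire_extension :: "(real \<Rightarrow> real) \<Rightarrow> bool" where
  "has_entire_extension f \<longleftrightarrow>
     (\<exists>g. g holomorphic_on UNIV \<and> (\<forall>x\<in>{0..1}. g (complex_of_real x) = complex_of_real (f x)))"

definition isometric_embedding_unit :: "(real \<Rightarrow> L1) \<Rightarrow> bool" where
  "isometric_embedding_unit F \<longleftrightarrow> (\<forall>s\<in>{0..1}. \<forall>t\<in>{0..1}. norm (F t - F s) = \<bar>t - s\<bar>)"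

definition differentiability_point :: "(real \<Rightarrow> L1) \<Rightarrow> real \<Rightarrow> bool" where
  "differentiability_point F t \<longleftrightarrow>
     t \<in> {0..1} \<and> (\<exists>D. (F has_vector_derivative D) (at t within {0..1}))"

end

theory Submission
  imports Defs "HOL-Complex_Analysis.Complex_Analysis"
begin

text \<open>
  If \<open>F\<^sub>t(x)\<close> is nondecreasing in \<open>t\<close> and \<open>F\<^sub>t\<close> has integral \<open>t\<close>, then \<open>F\<close> is isometric.
  Such an \<open>F\<close> is built as the integral in \<open>t\<close> of a dyadic-like martingale of polynomial
  probability densities \<open>M'\<close> in \<open>x\<close>: on a cell of \<open>[0,1]\<close> the density \<open>M'\<close> is split into
  \<open>(M\<^sup>2)'\<close> and \<open>(2M - M\<^sup>2)'\<close>, which are again densities with average \<open>M'\<close>, on alternating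
  subcells of length \<open>1/N\<close>. This changes \<open>F\<^sub>t\<close> by at most \<open>1/N\<close> times the polynomial
  \<open>(M\<^sup>2 - M)'\<close>. Only finitely many polynomials occur at each level, and a polynomial has only
  finitely many nonzero derivatives, so \<open>N\<close> can be taken so large that all derivative bounds hold
  and the series of corrections converges to an entire function. However fine the cells,
  the difference quotient of \<open>F\<close> over a cell and that over any of its subcells
  differ by \<open>\<parallel>(M\<^sup>2 - M)'\<parallel> \<ge> 1/3\<close> in \<open>L\<^sub>1\<close>, which excludes differentiability everywhere.
\<close>

section \<open>Triangle wave and grid cells\<close>

text \<open>This is the distance from \<open>u\<close> to the nearest even integer: a zigzag of
  slope 1 on even unit cells and slope -1 on odd ones.\<close>

definition triangle :: "real \<Rightarrow> real" where
  "triangle u = (if even \<lfloor>u\<rfloor> then frac u else 1 - frac u)"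

lemma triangle_bounds: "0 \<le> triangle u" "triangle u \<le> 1"
  using frac_ge_0[of u] frac_lt_1[of u] by (auto simp: triangle_def)

lemma triangle_even [simp]: "even a \<Longrightarrow> triangle (of_int a) = 0"
  by (simp add: triangle_def)

text \<open>Both ends of the cell are allowed: at the right end the floor is already
  \<open>a + 1\<close>, but the zigzag is continuous there.\<close>

lemma triangle_affine:
  assumes "of_int a \<le> u" "u \<le> of_int a + 1"
  shows "triangle u = (if even a then u - of_int a else 1 - (u - of_int a))"
proof (cases "u = of_int a + 1")
  case True
  then have "u = of_int (a + 1)" by simp
  then show ?thesis by (simp add: triangle_def del: of_int_add)
next
  case False
  then have "\<lfloor>u\<rfloor> = a" using assms by (intro floor_unique) auto
  then show ?thesis by (simp add: triangle_def frac_def)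
qed

text \<open>Induction on the difference of the cell indices of \<open>t\<close> and
  \<open>s\<close>: inside one cell the hypothesis applies, otherwise \<open>s\<close> is first
  moved to the next grid point \<open>r\<close>.\<close>

lemma mono_if_mono_on_cells:
  fixes f :: "real \<Rightarrow> real"
  assumes "N > 0"
    and step: "\<And>(a::int) s t. of_int a \<le> N * s \<Longrightarrow> s \<le> t \<Longrightarrow> N * t \<le> of_int a + 1 \<Longrightarrow> f s \<le> f t"
    and "s \<le> t"
  shows "f s \<le> f t"
  using \<open>s \<le> t\<close>
proof (induction "nat (\<lfloor>N * t\<rfloor> - \<lfloor>N * s\<rfloor>)" arbitrary: s)
  case 0
  have "N * s \<le> N * t" using \<open>N > 0\<close> 0 by simp
  then have "\<lfloor>N * t\<rfloor> = \<lfloor>N * s\<rfloor>" using 0 floor_mono[of "N * s" "N * t"] by simp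
  then show ?case using 0 by (intro step[of "\<lfloor>N * s\<rfloor>"]) linarith+
next
  case (Suc n)
  define r where "r = (of_int \<lfloor>N * s\<rfloor> + 1) / N"
  have Nr: "N * r = of_int (\<lfloor>N * s\<rfloor> + 1)" using \<open>N > 0\<close> by (simp add: r_def)
  then have fl: "\<lfloor>N * r\<rfloor> = \<lfloor>N * s\<rfloor> + 1" by (metis floor_of_int)
  have "N * s \<le> N * r" unfolding Nr by linarith
  then have "s \<le> r" using \<open>N > 0\<close> by simp
  have "\<lfloor>N * s\<rfloor> + 1 \<le> \<lfloor>N * t\<rfloor>" using Suc.hyps(2) by linarith
  then have "N * r \<le> N * t" unfolding Nr by (simp add: le_floor_iff)
  then have "r \<le> t" using \<open>N > 0\<close> by simp
  have "f s \<le> f r" using \<open>s \<le> r\<close> Nr by (intro step[of "\<lfloor>N * s\<rfloor>"]) auto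
  also have "f r \<le> f t" using \<open>r \<le> t\<close> Suc.hyps(2) fl by (intro Suc.hyps(1)) auto
  finally show ?case .
qed

text \<open>Cells closed on the right also cover \<open>u = of_int q\<close>; this is how the point
  1 later finds its cell.\<close>

lemma exists_subcell:
  fixes p q :: int and u :: real
  assumes "of_int p \<le> u" "u \<le> of_int q" "p < q"
  shows "\<exists>a\<ge>p. a < q \<and> of_int a \<le> u \<and> u \<le> of_int a + 1"
proof (cases "u = of_int q")
  case True
  then show ?thesis using assms by (intro exI[of _ "q - 1"]) auto
next
  case False
  then have "u < of_int q" using assms by simp
  then show ?thesis using assms by (intro exI[of _ "\<lfloor>u\<rfloor>"]) (auto simp: le_floor_iff floor_less_iff)
qed

section \<open>Bounds for polynomials and all their derivatives\<close>

lemma degree_higher_pderiv_le: "degree ((pderiv ^^ m) p) = degree (p :: real poly) - m"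
  by (induction m) (auto simp: degree_pderiv)

lemma higher_pderiv_eq_0:
  assumes "m > degree (p :: real poly)"
  shows "(pderiv ^^ m) p = 0"
proof -
  obtain k where m: "m = Suc k" "k \<ge> degree p" using assms by (cases m) auto
  then show ?thesis by (simp add: pderiv_eq_0_iff degree_higher_pderiv_le)
qed

text \<open>Derivatives beyond the degree vanish, so only finitely many suprema have to be dominated
  and one constant serves every \<open>m\<close>, however fast \<open>w\<close> decays.\<close>

lemma higher_pderiv_weighted_bound:
  fixes p :: "real poly" and w :: "nat \<Rightarrow> real"
  assumes "\<And>m. w m > 0"
  shows "\<exists>C. \<forall>m. \<forall>x\<in>{0..1}. \<bar>poly ((pderiv ^^ m) p) x\<bar> \<le> C * w m"
proof -
  have "\<exists>B. \<forall>x\<in>{0..1}. \<bar>poly ((pderiv ^^ m) p) x\<bar> \<le> B" for m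
  proof -
    have "compact ((poly ((pderiv ^^ m) p)) ` {0..1::real})"
      by (intro compact_continuous_image continuous_intros) auto
    from compact_imp_bounded[OF this] show ?thesis by (auto simp: bounded_iff)
  qed
  then obtain B where B: "\<And>m x. x \<in> {0..1} \<Longrightarrow> \<bar>poly ((pderiv ^^ m) p) x\<bar> \<le> B m" by metis
  have Bnn: "B m \<ge> 0" for m using B[of 0 m] by auto
  define C where "C = (\<Sum>m\<le>degree p. B m / w m)"
  have C0: "C \<ge> 0" unfolding C_def using Bnn assms by (intro sum_nonneg divide_nonneg_pos) auto
  show ?thesis
  proof (intro exI[of _ C] allI ballI)
    fix m and x :: real assume x: "x \<in> {0..1}"
    show "\<bar>poly ((pderiv ^^ m) p) x\<bar> \<le> C * w m"
    proof (cases "m \<le> degree p")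
      case True
      have "B m / w m \<le> C" unfolding C_def using True Bnn assms
        by (intro member_le_sum[of m _ "\<lambda>m. B m / w m"] divide_nonneg_pos) auto
      then have "B m \<le> C * w m" using assms[of m] by (simp add: pos_divide_le_eq)
      then show ?thesis using B[OF x, of m] by linarith
    next
      case False
      then show ?thesis using higher_pderiv_eq_0[of p m] C0 assms[of m] by simp
    qed
  qed
qed

abbreviation cpoly :: "real poly \<Rightarrow> complex \<Rightarrow> complex" where
  "cpoly p \<equiv> poly (map_poly complex_of_real p)"

lemma cpoly_of_real: "cpoly p (of_real x) = of_real (poly p x)"
  by (induction p) (simp_all add: map_poly_pCons)

lemma cpoly_bound:
  "\<exists>C. \<forall>z. norm z \<le> r \<longrightarrow> norm (cpoly p z) \<le> C"
proof -
  have "compact (cpoly p ` cball 0 r)" by (intro compact_continuous_image continuous_intros) auto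
  from compact_imp_bounded[OF this] obtain C where "\<forall>y\<in>cpoly p ` cball 0 r. norm y \<le> C"
    unfolding bounded_iff by blast
  then show ?thesis by (intro exI[of _ C]) auto
qed

section \<open>Polynomial distribution functions and their splittings\<close>

text \<open>
  Iterating \<open>M \<mapsto> M\<^sup>2\<close> and \<open>M \<mapsto> 2M - M\<^sup>2\<close> keeps distribution functions on \<open>[0,1]\<close>
  and replaces \<open>M\<close> by two of them with mean \<open>M\<close>.
\<close>

primrec cdfs :: "nat \<Rightarrow> real poly set" where
  "cdfs 0 = {[:0, 1:]}"
| "cdfs (Suc k) = (\<lambda>M. M\<^sup>2) ` cdfs k \<union> (\<lambda>M. 2 * M - M\<^sup>2) ` cdfs k"

lemma finite_cdfs: "finite (cdfs k)"
  by (induction k) auto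

definition is_cdf :: "real poly \<Rightarrow> bool" where
  "is_cdf M \<longleftrightarrow> poly M 0 = 0 \<and> poly M 1 = 1 \<and>
    (\<forall>x\<in>{0..1}. 0 \<le> poly M x \<and> poly M x \<le> 1 \<and> 0 \<le> poly (pderiv M) x)"

lemma pderiv_sq: "pderiv (M\<^sup>2) = 2 * M * pderiv (M :: real poly)"
  by (simp add: power2_eq_square pderiv_mult)

lemma pderiv_2: "pderiv (2 * M) = 2 * pderiv (M :: real poly)"
  by (simp only: mult_2 pderiv_add)

lemmas cdf_pderivs = pderiv_sq pderiv_2 pderiv_diff

text \<open>With \<open>y\<close> and \<open>d\<close> the values of \<open>L\<close> and of its
  derivative, the two splittings have derivatives 2yd and 2(1 - y)d, both nonnegative as y is in
  [0,1].\<close>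

lemma cdfs_is_cdf: "M \<in> cdfs k \<Longrightarrow> is_cdf M"
proof (induction k arbitrary: M)
  case 0
  then show ?case by (auto simp: is_cdf_def pderiv_pCons)
next
  case (Suc k)
  from Suc.prems obtain L where L: "L \<in> cdfs k" and M: "M = L\<^sup>2 \<or> M = 2 * L - L\<^sup>2" by auto
  have c: "is_cdf L" using Suc.IH L by blast
  have "0 \<le> poly M x \<and> poly M x \<le> 1 \<and> 0 \<le> poly (pderiv M) x" if "x \<in> {0..1}" for x
  proof -
    define y where "y = poly L x"
    define d where "d = poly (pderiv L) x"
    have y: "0 \<le> y" "y \<le> 1" "0 \<le> d" using c that by (auto simp: is_cdf_def y_def d_def)
    have "0 \<le> y * d" "y * d \<le> d" using y by (auto intro: mult_left_le_one_le)
    moreover have "y\<^sup>2 \<le> 1" "y\<^sup>2 \<le> y" "0 \<le> (1 - y)\<^sup>2" using y by (auto simp: power2_eq_square intro: mult_le_one mult_left_le)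
    moreover have "2 * y - y\<^sup>2 \<le> 1" using \<open>0 \<le> (1 - y)\<^sup>2\<close> by (simp add: power2_diff)
    moreover have "poly M x = y\<^sup>2 \<and> poly (pderiv M) x = 2 * (y * d) \<or>
        poly M x = 2 * y - y\<^sup>2 \<and> poly (pderiv M) x = 2 * d - 2 * (y * d)"
      using M by (elim disjE) (simp_all add: cdf_pderivs y_def d_def)
    ultimately show ?thesis using y by auto
  qed
  then show ?case using M c by (auto simp: is_cdf_def)
qed

text \<open>The integrand is M' |2M - 1|. Since |2M - 1| \<le> 1, it is at least M' (2M - 1)^2,
  which has the primitive (2M - 1)^3 / 6; this avoids locating the sign change of 2M - 1.\<close>

lemma cdf_split_separation:
  assumes "is_cdf M"
  shows "1/3 \<le> integral {0..1} (\<lambda>x. \<bar>poly (pderiv (M\<^sup>2 - M)) x\<bar>)"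
proof -
  have "((\<lambda>x. poly (pderiv M) x * (2 * poly M x - 1)\<^sup>2) has_integral
      ((2 * poly M 1 - 1) ^ 3 / 6 - (2 * poly M 0 - 1) ^ 3 / 6)) {0..1}"
  proof (rule fundamental_theorem_of_calculus)
    fix x :: real
    have "((\<lambda>x. (2 * poly M x - 1) ^ 3 / 6) has_real_derivative
        poly (pderiv M) x * (2 * poly M x - 1)\<^sup>2) (at x within {0..1})"
      by (rule derivative_eq_intros refl | simp)+
    then show "((\<lambda>x. (2 * poly M x - 1) ^ 3 / 6) has_vector_derivative
        poly (pderiv M) x * (2 * poly M x - 1)\<^sup>2) (at x within {0..1})"
      by (simp add: has_real_derivative_iff_has_vector_derivative)
  qed simp
  then have "((\<lambda>x. poly (pderiv M) x * (2 * poly M x - 1)\<^sup>2) has_integral 1/3) {0..1}"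
    using assms by (simp add: is_cdf_def)
  moreover have "((\<lambda>x. \<bar>poly (pderiv (M\<^sup>2 - M)) x\<bar>) has_integral
      integral {0..1} (\<lambda>x. \<bar>poly (pderiv (M\<^sup>2 - M)) x\<bar>)) {0..1}"
    by (intro integrable_integral integrable_continuous_real continuous_intros)
  ultimately show ?thesis
  proof (rule has_integral_le)
    fix x :: real assume x: "x \<in> {0..1}"
    define y where "y = poly M x"
    define d where "d = poly (pderiv M) x"
    have y: "0 \<le> y" "y \<le> 1" "0 \<le> d" using assms x by (auto simp: is_cdf_def y_def d_def)
    have "\<bar>2 * y - 1\<bar> * \<bar>2 * y - 1\<bar> \<le> 1 * \<bar>2 * y - 1\<bar>" using y by (intro mult_right_mono) auto
    then have "(2 * y - 1)\<^sup>2 \<le> \<bar>2 * y - 1\<bar>" by (simp add: power2_eq_square flip: abs_mult)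
    then have "d * (2 * y - 1)\<^sup>2 \<le> d * \<bar>2 * y - 1\<bar>" using y by (intro mult_left_mono) auto
    also have "\<dots> = \<bar>d * (2 * y - 1)\<bar>" using y by (simp add: abs_mult)
    finally show "poly (pderiv M) x * (2 * poly M x - 1)\<^sup>2 \<le> \<bar>poly (pderiv (M\<^sup>2 - M)) x\<bar>"
      by (simp add: cdf_pderivs y_def d_def algebra_simps)
  qed
qed

section \<open>Difference quotients and continuous representatives in L1\<close>

text \<open>Since \<open>t\<close> lies between \<open>a\<close> and \<open>b\<close>, the errors at
  both ends add up to at most \<open>e * (b - a)\<close>. So every short interval around
  \<open>t\<close> has a quotient near \<open>D\<close>, wherever in it \<open>t\<close>
  lies.\<close>

lemma straddled_difference_quotient:
  fixes F :: "real \<Rightarrow> 'a :: real_normed_vector"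
  assumes "(F has_vector_derivative D) (at t within {0..1})" "e > 0"
  shows "\<exists>d>0. \<forall>a b. 0 \<le> a \<and> a \<le> t \<and> t \<le> b \<and> b \<le> 1 \<and> b - a < d \<longrightarrow>
    norm (F b - F a - (b - a) *\<^sub>R D) \<le> e * (b - a)"
proof -
  from assms have "\<exists>d>0. \<forall>y\<in>{0..1}. norm (y - t) < d \<longrightarrow> norm (F y - F t - (y - t) *\<^sub>R D) \<le> e * norm (y - t)"
    unfolding has_vector_derivative_def has_derivative_within_alt by blast
  then obtain d where d: "d > 0" and *: "\<And>y. y \<in> {0..1} \<Longrightarrow> \<bar>y - t\<bar> < d \<Longrightarrow>
      norm (F y - F t - (y - t) *\<^sub>R D) \<le> e * \<bar>y - t\<bar>" by (auto simp: real_norm_def)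
  show ?thesis
  proof (intro exI[of _ d] conjI allI impI d)
    fix a b assume ab: "0 \<le> a \<and> a \<le> t \<and> t \<le> b \<and> b \<le> 1 \<and> b - a < d"
    have "F b - F a - (b - a) *\<^sub>R D = (F b - F t - (b - t) *\<^sub>R D) - (F a - F t - (a - t) *\<^sub>R D)"
      by (simp add: algebra_simps)
    also have "norm \<dots> \<le> e * \<bar>b - t\<bar> + e * \<bar>a - t\<bar>"
      using ab by (intro order_trans[OF norm_triangle_ineq4] add_mono *) auto
    also have "\<dots> = e * (b - a)" using ab by (simp add: algebra_simps)
    finally show "norm (F b - F a - (b - a) *\<^sub>R D) \<le> e * (b - a)" .
  qed
qed

lemma L1_rel_refl_continuous: "continuous_on {0..1} f \<Longrightarrow> L1_rel f f"
  by (simp add: L1_rel_def continuous_imp_integrable_real)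

lemma norm_abs_L1:
  assumes "continuous_on {0..1} f"
  shows "norm (abs_L1 f) = integral {0..1} (\<lambda>x. \<bar>f x\<bar>)"
proof -
  have "norm (abs_L1 f) = (LINT x|unit_leb. \<bar>f x\<bar>)"
    using norm_L1.abs_eq[OF L1_rel_refl_continuous[OF assms]] .
  also have "\<dots> = integral {0..1} (\<lambda>x. \<bar>f x\<bar>)"
    using assms by (intro lebesgue_integral_eq_integral continuous_imp_integrable_real continuous_intros) auto
  finally show ?thesis .
qed

lemma abs_L1_diff:
  assumes "continuous_on {0..1} f" "continuous_on {0..1} g"
  shows "abs_L1 f - abs_L1 g = abs_L1 (\<lambda>x. f x - g x)"
  using assms by (intro minus_L1.abs_eq L1_rel_refl_continuous)

lemma abs_L1_scaleR:
  assumes "continuous_on {0..1} f"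
  shows "c *\<^sub>R abs_L1 f = abs_L1 (\<lambda>x. c * f x)"
  using assms by (intro scaleR_L1.abs_eq L1_rel_refl_continuous)

text \<open>Here \<open>v\<close> is measured in coarse cells and \<open>of_int q * v\<close> in
  fine ones, and the fine cell \<open>a\<close> lies in the coarse cell \<open>b\<close>. The strict
  form serves half-open cells, on which the floor is constant.\<close>

lemma subcell:
  fixes a b q :: int and v :: real
  assumes "0 < q" "q * b \<le> a" "a + 1 \<le> q * (b + 1)"
  shows "of_int a \<le> of_int q * v \<Longrightarrow> of_int b \<le> v"
    and "of_int q * v \<le> of_int a + 1 \<Longrightarrow> v \<le> of_int b + 1"
    and "of_int q * v < of_int a + 1 \<Longrightarrow> v < of_int b + 1"
proof -
  have q: "0 < real_of_int q" using assms by simp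
  have l: "real_of_int q * of_int b \<le> of_int a"
    using assms(2) by (metis of_int_le_iff of_int_mult)
  have "real_of_int (a + 1) \<le> of_int (q * (b + 1))" using assms(3) by (simp only: of_int_le_iff)
  then have u: "real_of_int a + 1 \<le> of_int q * (of_int b + 1)" by simp
  show "of_int b \<le> v" if "of_int a \<le> of_int q * v"
    using order_trans[OF l that] q by simp
  show "v \<le> of_int b + 1" if "of_int q * v \<le> of_int a + 1"
    using order_trans[OF that u] q by (simp only: mult_le_cancel_left_pos)
  show "v < of_int b + 1" if "of_int q * v < of_int a + 1"
    using less_le_trans[OF that u] q by (simp only: mult_less_cancel_left_pos)
qed

section \<open>The path for given scales\<close>

text \<open>The ratio of successive scales is even, so that grid points of one level are zeros of
  the triangle waves of all finer ones. The bounds make the corrections, once divided by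
  \<open>N (Suc k)\<close>, summable: on [0,1] with total at most \<open>w m\<close>, and on each
  disc from some level on.\<close>

locale scales =
  fixes N :: "nat \<Rightarrow> int" and w :: "nat \<Rightarrow> real"
  assumes N_0: "N 0 = 1"
    and N_Suc: "\<exists>c\<ge>1. N (Suc k) = 2 * c * N k"
    and real_bound: "M \<in> cdfs k \<Longrightarrow> x \<in> {0..1} \<Longrightarrow>
      \<bar>poly ((pderiv ^^ m) (M\<^sup>2 - M)) x\<bar> \<le> of_int (N (Suc k)) * (w m * (1/2) ^ Suc k)"
    and complex_bound: "M \<in> cdfs k \<Longrightarrow> norm z \<le> real k \<Longrightarrow>
      norm (cpoly (pderiv (M\<^sup>2 - M)) z) \<le> of_int (N (Suc k)) * (1/2) ^ k"
begin

primrec cell_cdf :: "nat \<Rightarrow> real \<Rightarrow> real poly" where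
  "cell_cdf 0 t = [:0, 1:]"
| "cell_cdf (Suc k) t = (if even \<lfloor>of_int (N (Suc k)) * t\<rfloor> then (cell_cdf k t)\<^sup>2 else 2 * cell_cdf k t - (cell_cdf k t)\<^sup>2)"

text \<open>
  \<open>(cell_cdf k t)'\<close> is the slope of \<open>path_upto k\<close> on the level-\<open>k\<close> cell containing \<open>t\<close>; see
  \<open>path_upto_affine\<close>. The term \<open>m = 0\<close> of \<open>wave\<close> is a primitive of the oscillating part of \<open>path\<close>.
\<close>

definition wobble :: "nat \<Rightarrow> real \<Rightarrow> real poly" where
  "wobble k t = (cell_cdf k t)\<^sup>2 - cell_cdf k t"

definition height :: "nat \<Rightarrow> real \<Rightarrow> real" where
  "height k t = triangle (of_int (N (Suc k)) * t) / of_int (N (Suc k))"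

definition wave :: "nat \<Rightarrow> real \<Rightarrow> real \<Rightarrow> real" where
  "wave m t x = (\<Sum>k. height k t * poly ((pderiv ^^ m) (wobble k t)) x)"

definition path :: "real \<Rightarrow> real \<Rightarrow> real" where
  "path t x = t + wave 1 t x"

definition path_upto :: "nat \<Rightarrow> real \<Rightarrow> real \<Rightarrow> real" where
  "path_upto K t x = t + (\<Sum>k<K. height k t * poly (pderiv (wobble k t)) x)"

lemma N_ge: "2 ^ k \<le> N k"
proof (induction k)
  case (Suc k)
  obtain c where c: "c \<ge> 1" "N (Suc k) = 2 * c * N k" using N_Suc by blast
  have "0 < N k" using Suc.IH by (rule less_le_trans[rotated]) simp
  then have "1 * N k \<le> c * N k" using c by (intro mult_right_mono) auto
  then show ?case using Suc c by simp
qed (simp add: N_0)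

lemma N_pos [simp]: "0 < N k"
  using N_ge[of k] by (rule less_le_trans[rotated]) simp

lemma N_nonneg [simp]: "0 \<le> N k"
  by (rule less_imp_le) (rule N_pos)

lemma N_nonzero [simp]: "N k \<noteq> 0"
  by (rule less_imp_neq[symmetric]) (rule N_pos)

lemma N_dvd: "K \<le> k \<Longrightarrow> 2 * N K dvd N (Suc k)"
proof (induction k rule: dec_induct)
  case base
  show ?case using N_Suc[of K] by auto
next
  case (step k)
  then show ?case using N_Suc[of "Suc k"] by (metis dvd_mult dvd_trans)
qed

lemma cell_cdf_in_cdfs: "cell_cdf k t \<in> cdfs k"
  by (induction k) auto

lemmas cell_cdf_is_cdf = cell_cdf_in_cdfs[THEN cdfs_is_cdf]

lemma height_bounds: "0 \<le> height k t" "height k t \<le> 1 / of_int (N (Suc k))"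
  using triangle_bounds[of "of_int (N (Suc k)) * t"] by (auto simp: height_def divide_right_mono less_imp_le)

text \<open>The bound 1/N on \<open>height\<close> cancels the factor N in the assumptions on the
  scales; the type covers real and complex values at once.\<close>

lemma norm_height_mult_le:
  fixes y :: "'a :: real_normed_div_algebra"
  assumes "norm y \<le> of_int (N (Suc k)) * b"
  shows "norm (of_real (height k t) * y) \<le> b"
proof -
  have "norm (of_real (height k t) * y) \<le> 1 / of_int (N (Suc k)) * (of_int (N (Suc k)) * b)"
    unfolding norm_mult using height_bounds assms by (intro mult_mono) auto
  also have "\<dots> = b" by simp
  finally show ?thesis .
qed

section \<open>Convergence and termwise differentiation of the series\<close>

lemma term_bound:
  assumes "x \<in> {0..1}"
  shows "\<bar>height k t * poly ((pderiv ^^ m) (wobble k t)) x\<bar> \<le> w m * (1/2) ^ Suc k"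
  using norm_height_mult_le[of "poly ((pderiv ^^ m) (wobble k t)) x" k "w m * (1/2) ^ Suc k" t]
    real_bound[OF cell_cdf_in_cdfs assms, where m = m]
  by (simp add: wobble_def)

lemma geometric_sums: "(\<lambda>k. w m * (1/2) ^ Suc k) sums w m"
  using sums_mult[OF power_half_series, of "w m"] by simp

lemma wave_summable:
  assumes "x \<in> {0..1}"
  shows "summable (\<lambda>k. height k t * poly ((pderiv ^^ m) (wobble k t)) x)"
  by (rule summable_comparison_test'[OF sums_summable[OF geometric_sums[of m]]])
    (unfold real_norm_def, rule term_bound[OF assms])

lemma wave_bound:
  assumes "x \<in> {0..1}"
  shows "\<bar>wave m t x\<bar> \<le> w m"
proof -
  have "norm (wave m t x) \<le> (\<Sum>k. w m * (1/2) ^ Suc k)"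
    unfolding wave_def
    by (rule norm_suminf_le[OF _ sums_summable[OF geometric_sums[of m]]])
      (unfold real_norm_def, rule term_bound[OF assms])
  then show ?thesis unfolding real_norm_def sums_unique[OF geometric_sums[of m], symmetric] .
qed

text \<open>Termwise differentiation is justified because the differentiated series has a geometric
  majorant and hence converges uniformly on [0,1].\<close>

lemma wave_deriv:
  assumes "x \<in> {0..1}"
  shows "(wave m t has_real_derivative wave (Suc m) t x) (at x within {0..1})"
proof -
  let ?f = "\<lambda>m k x. height k t * poly ((pderiv ^^ m) (wobble k t)) x"
  have "uniform_limit {0..1} (\<lambda>n x. \<Sum>k<n. ?f (Suc m) k x) (wave (Suc m) t) sequentially"
    unfolding wave_def
  proof (rule Weierstrass_m_test)
    show "norm (?f (Suc m) k x) \<le> w (Suc m) * (1/2) ^ Suc k" if "x \<in> {0..1}" for k x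
      unfolding real_norm_def by (rule term_bound[OF that])
    show "summable (\<lambda>k. w (Suc m) * (1/2) ^ Suc k)" using geometric_sums[of "Suc m"] by (rule sums_summable)
  qed
  moreover have "(?f m k has_real_derivative ?f (Suc m) k y) (at y within {0..1})" for k y
    by (auto intro!: DERIV_cmult DERIV_subset[OF poly_DERIV])
  ultimately have "\<exists>h. \<forall>y\<in>{0..1}. (\<lambda>k. ?f m k y) sums h y \<and>
      (h has_real_derivative wave (Suc m) t y) (at y within {0..1})"
    by (intro has_field_derivative_series[where f' = "?f (Suc m)" and ?x0.0 = 0] wave_summable) auto
  then obtain h where h: "\<And>y. y \<in> {0..1} \<Longrightarrow> (\<lambda>k. ?f m k y) sums h y"
      "\<And>y. y \<in> {0..1} \<Longrightarrow> (h has_real_derivative wave (Suc m) t y) (at y within {0..1})"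
    by blast
  have "h y = wave m t y" if "y \<in> {0..1}" for y
    using h(1)[OF that] by (simp add: wave_def sums_iff)
  then show ?thesis
    by (rule has_field_derivative_transform_within[OF h(2)[OF assms] zero_less_one assms])
qed

text \<open>The value formula on all of [0,1] yields the derivative, and uniqueness of derivatives
  yields the formula for the next \<open>m\<close>. The summand \<open>t\<close> is constant in
  \<open>x\<close>, so it survives only for \<open>m = 0\<close>.\<close>

lemma path_deriv:
  assumes "x \<in> {0..1}"
  shows "unit_deriv m (path t) x = (if m = 0 then t else 0) + wave (Suc m) t x"
    and "(unit_deriv m (path t) has_real_derivative wave (Suc (Suc m)) t x) (at x within {0..1})"
proof -
  have D: "(unit_deriv m (path t) has_real_derivative wave (Suc (Suc m)) t x) (at x within {0..1})"
    if val: "\<And>x. x \<in> {0..1} \<Longrightarrow> unit_deriv m (path t) x = (if m = 0 then t else 0) + wave (Suc m) t x"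
      and x: "x \<in> {0..1}" for m x
  proof -
    have "((\<lambda>x. (if m = 0 then t else 0) + wave (Suc m) t x) has_real_derivative wave (Suc (Suc m)) t x) (at x within {0..1})"
      using wave_deriv[OF x] by (auto intro!: derivative_eq_intros)
    then show ?thesis
      by (rule has_field_derivative_transform_within[OF _ zero_less_one x]) (simp only: val)
  qed
  have V: "\<forall>x\<in>{0..1}. unit_deriv m (path t) x = (if m = 0 then t else 0) + wave (Suc m) t x"
  proof (induction m)
    case 0
    show ?case by (simp add: path_def)
  next
    case (Suc m)
    show ?case
    proof
      fix x :: real assume x: "x \<in> {0..1}"
      have "(unit_deriv m (path t) has_vector_derivative wave (Suc (Suc m)) t x) (at x within {0..1})"
        using D[of m x] Suc x by (simp add: has_real_derivative_iff_has_vector_derivative)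
      then show "unit_deriv (Suc m) (path t) x = (if Suc m = 0 then t else 0) + wave (Suc (Suc m)) t x"
        using x by (simp add: vector_derivative_within_closed_interval)
    qed
  qed
  then show "unit_deriv m (path t) x = (if m = 0 then t else 0) + wave (Suc m) t x" using assms by blast
  from D[of m x] V assms show "(unit_deriv m (path t) has_real_derivative wave (Suc (Suc m)) t x) (at x within {0..1})"
    by blast
qed

lemma smooth_path: "smooth_on_unit (path t)"
  unfolding smooth_on_unit_def differentiable_on_def
  using path_deriv(2) real_differentiable_def by blast

lemma path_continuous: "continuous_on {0..1} (path t)"
  using path_deriv(2)[where m = 0 and t = t] by (intro DERIV_continuous_on[of _ _ "wave 2 t"]) (simp add: numeral_2_eq_2)

lemma wobble_ends: "poly (wobble k t) 0 = 0" "poly (wobble k t) 1 = 0"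
  using cell_cdf_is_cdf[of k t] by (auto simp: is_cdf_def wobble_def)

text \<open>The oscillating part \<open>wave 1 t\<close> has the primitive \<open>wave 0 t\<close>,
  which vanishes at both ends because M^2 - M does where M is 0 or 1. So it does not affect the
  mean.\<close>

lemma path_integral: "(path t has_integral t) {0..1}"
proof -
  have "(wave 1 t has_integral (wave 0 t 1 - wave 0 t 0)) {0..1}"
    using wave_deriv[where m = 0]
    by (intro fundamental_theorem_of_calculus) (auto simp: has_real_derivative_iff_has_vector_derivative)
  moreover have "wave 0 t 0 = 0" "wave 0 t 1 = 0" by (auto simp: wave_def wobble_ends)
  moreover have "((\<lambda>x::real. t) has_integral t) {0..1}"
    using has_integral_const_real[of t 0 1] by simp
  ultimately have "((\<lambda>x. t + wave 1 t x) has_integral (t + 0)) {0..1}"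
    by (intro has_integral_add) auto
  then show ?thesis by (simp add: path_def[abs_def])
qed

section \<open>Entire extension\<close>

text \<open>Any closed disc of radius 1 is contained in the disc of radius \<open>k\<close> about 0
  for large \<open>k\<close>, so \<open>complex_bound\<close> gives a geometric majorant for the
  tail and locally uniform convergence.\<close>

lemma path_entire: "has_entire_extension (path t)"
  unfolding has_entire_extension_def
proof (intro exI conjI ballI)
  let ?h = "\<lambda>k z. of_real (height k t) * cpoly (pderiv (wobble k t)) z"
  let ?G = "\<lambda>z. of_real t + (\<Sum>k. ?h k z)"
  have "(\<lambda>z. \<Sum>k. ?h k z) holomorphic_on UNIV"
  proof (rule holomorphic_uniform_sequence)
    show "(\<lambda>z. \<Sum>k<n. ?h k z) holomorphic_on UNIV" for n by (intro holomorphic_intros)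
    fix z :: complex
    have "uniform_limit (cball z 1) (\<lambda>n z. \<Sum>k<n. ?h k z) (\<lambda>z. \<Sum>k. ?h k z) sequentially"
    proof (rule Weierstrass_m_test_ev)
      show "summable (\<lambda>k. (1/2::real) ^ k)" by (intro summable_geometric) simp
      have "\<forall>\<^sub>F k in sequentially. norm z + 1 \<le> real k" by real_asymp
      then show "\<forall>\<^sub>F k in sequentially. \<forall>y\<in>cball z 1. norm (?h k y) \<le> (1/2) ^ k"
      proof eventually_elim
        case (elim k)
        show ?case
        proof
          fix y assume "y \<in> cball z 1"
          then have "norm y \<le> real k" using elim norm_triangle_sub[of y z] by (simp add: dist_norm norm_minus_commute)
          then show "norm (?h k y) \<le> (1/2) ^ k"
            unfolding wobble_def by (intro norm_height_mult_le complex_bound cell_cdf_in_cdfs)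
        qed
      qed
    qed
    then show "\<exists>d>0. cball z d \<subseteq> UNIV \<and> uniform_limit (cball z d) (\<lambda>n z. \<Sum>k<n. ?h k z) (\<lambda>z. \<Sum>k. ?h k z) sequentially"
      by (intro exI[of _ 1]) auto
  qed simp
  then show "?G holomorphic_on UNIV" by (intro holomorphic_intros)
  fix x :: real assume x: "x \<in> {0..1}"
  have "(\<Sum>k. ?h k (of_real x)) = of_real (wave 1 t x)"
    unfolding wave_def using wave_summable[OF x, of t 1]
    by (simp add: cpoly_of_real suminf_of_real flip: of_real_mult)
  then show "?G (of_real x) = of_real (path t x)" by (simp add: path_def)
qed

section \<open>Affine behaviour on cells, monotonicity and isometry\<close>

text \<open>The coarse scale divides the fine one, so a fine cell index determines all coarser ones
  by integer division.\<close>

lemma floor_N_mult: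
  fixes t :: real
  assumes "K \<le> k"
  shows "\<lfloor>of_int (N K) * t\<rfloor> = \<lfloor>of_int (N k) * t\<rfloor> div (N k div N K)"
proof -
  have "N K dvd N k"
  proof (cases "K = k")
    case False
    then have "K \<le> k - 1" "Suc (k - 1) = k" using assms by auto
    then show ?thesis using N_dvd[of K "k - 1"] by (metis dvd_mult_right)
  qed simp
  then obtain q where q: "N k = N K * q" by blast
  then have "0 < q" using N_pos by (metis zero_less_mult_pos)
  then have "of_int (N K) * t = of_int (N k) * t / of_int q"
    by (simp add: q)
  moreover have "N k div N K = q" by (simp add: q)
  ultimately show ?thesis using floor_divide_real_eq_div[of q "of_int (N k) * t"] \<open>0 < q\<close> by simp
qed

lemma cell_cdf_cong:
  assumes "\<lfloor>of_int (N k) * s\<rfloor> = \<lfloor>of_int (N k) * t\<rfloor>"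
  shows "cell_cdf k s = cell_cdf k t"
  using assms
proof (induction k)
  case (Suc k)
  then have "cell_cdf k s = cell_cdf k t"
    by (intro Suc.IH) (simp add: floor_N_mult[of k "Suc k"])
  then show ?case using Suc.prems by simp
qed simp

text \<open>\<open>N (Suc k)\<close> is an even multiple of \<open>N K\<close>, so the triangle wave
  is evaluated at an even integer.\<close>

lemma height_grid:
  assumes "of_int (N K) * t = of_int a" "K \<le> k"
  shows "height k t = 0"
proof -
  obtain c where "N (Suc k) = 2 * N K * c" using N_dvd[OF assms(2)] by blast
  then have "of_int (N (Suc k)) * t = 2 * of_int c * (of_int (N K) * t)" by simp
  also have "\<dots> = of_int (2 * c * a)" using assms by simp
  finally have "triangle (of_int (N (Suc k)) * t) = triangle (of_int (2 * c * a))" by simp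
  also have "\<dots> = 0" by (rule triangle_even) simp
  finally have "triangle (of_int (N (Suc k)) * t) = 0" .
  then show ?thesis by (simp add: height_def)
qed

text \<open>On an even cell \<open>height\<close> rises with slope 1 and M + (M^2 - M) = M^2; on an
  odd cell it falls and M - (M^2 - M) = 2M - M^2. The point \<open>r\<close> selects the density, so
  it is kept off the right end, while \<open>s\<close> and \<open>t\<close> may lie there.\<close>

lemma path_upto_affine:
  assumes "of_int a \<le> of_int (N K) * r" "of_int (N K) * r < of_int a + 1"
    and "of_int a \<le> of_int (N K) * s" "of_int (N K) * s \<le> of_int a + 1"
    and "of_int a \<le> of_int (N K) * t" "of_int (N K) * t \<le> of_int a + 1"
  shows "path_upto K t x - path_upto K s x = (t - s) * poly (pderiv (cell_cdf K r)) x"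
  using assms
proof (induction K arbitrary: a)
  case 0
  then show ?case by (simp add: path_upto_def pderiv_pCons)
next
  case (Suc K)
  obtain c where c: "c \<ge> 1" "N (Suc K) = 2 * c * N K" using N_Suc by blast
  define b where "b = a div (2 * c)"
  have q: "0 < 2 * c" using c by simp
  have b: "2 * c * b \<le> a" "a + 1 \<le> 2 * c * (b + 1)"
    unfolding b_def distrib_left
    using mult_div_mod_eq[of "2 * c" a] pos_mod_bound[OF q, of a] pos_mod_sign[OF q, of a]
    by linarith+
  have N_Suc_mult: "of_int (N (Suc K)) * u = of_int (2 * c) * (of_int (N K) * u)" for u :: real
    using c by simp
  have cell: "of_int b \<le> of_int (N K) * u \<and> of_int (N K) * u \<le> of_int b + 1"
    if "of_int a \<le> of_int (N (Suc K)) * u" "of_int (N (Suc K)) * u \<le> of_int a + 1" for u :: real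
    using that subcell(1,2)[OF q b] unfolding N_Suc_mult by blast
  have r: "of_int (N K) * r < of_int b + 1"
    using Suc.prems(2) subcell(3)[OF q b] unfolding N_Suc_mult by blast
  \<comment> \<open>At the right end of the coarse cell the floor has jumped and
    \<open>wobble K u\<close> may belong to the next cell, but \<open>height K u\<close> is 0
    there.\<close>
  have wiggle: "height K u * poly (pderiv (wobble K u)) x = height K u * poly (pderiv (wobble K r)) x"
    if u: "of_int a \<le> of_int (N (Suc K)) * u" "of_int (N (Suc K)) * u \<le> of_int a + 1" for u
  proof (cases "of_int (N K) * u = of_int b + 1")
    case True
    then have "height K u = 0" using height_grid[of K u "b + 1" K] by simp
    then show ?thesis by simp
  next
    case False
    then have "\<lfloor>of_int (N K) * u\<rfloor> = b" using cell[OF u] by (intro floor_unique) auto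
    moreover have "\<lfloor>of_int (N K) * r\<rfloor> = b" using cell[of r] Suc.prems r by (intro floor_unique) auto
    ultimately show ?thesis using cell_cdf_cong[of K u r] by (simp add: wobble_def)
  qed
  have slope: "height K t - height K s = (if even a then t - s else s - t)"
    using triangle_affine[OF Suc.prems(3,4)] triangle_affine[OF Suc.prems(5,6)]
    by (auto simp: height_def field_simps simp flip: diff_divide_distrib)
  have "\<lfloor>of_int (N (Suc K)) * r\<rfloor> = a" using Suc.prems by (intro floor_unique) auto
  then have split: "cell_cdf (Suc K) r = (if even a then (cell_cdf K r)\<^sup>2 else 2 * cell_cdf K r - (cell_cdf K r)\<^sup>2)" by simp
  have "path_upto (Suc K) t x - path_upto (Suc K) s x =
      (path_upto K t x - path_upto K s x) + (height K t - height K s) * poly (pderiv (wobble K r)) x"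
    by (simp only: path_upto_def sum.lessThan_Suc wiggle[OF Suc.prems(3,4)] wiggle[OF Suc.prems(5,6)])
      (simp only: algebra_simps)
  also have "path_upto K t x - path_upto K s x = (t - s) * poly (pderiv (cell_cdf K r)) x"
    using cell Suc.prems r by (intro Suc.IH[of b]) auto
  finally show ?case
    unfolding slope split by (auto simp: wobble_def cdf_pderivs algebra_simps)
qed

text \<open>On each closed cell the slope is a density, hence nonnegative.\<close>

lemma path_upto_mono:
  assumes "s \<le> t" "x \<in> {0..1}"
  shows "path_upto K s x \<le> path_upto K t x"
proof (rule mono_if_mono_on_cells[OF _ _ assms(1)])
  show "0 < real_of_int (N K)" by simp
  fix a :: int and s t :: real
  assume st: "of_int a \<le> of_int (N K) * s" "s \<le> t" "of_int (N K) * t \<le> of_int a + 1"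
  define r where "r = real_of_int a / of_int (N K)"
  have r: "of_int (N K) * r = of_int a" by (simp add: r_def)
  have le: "of_int (N K) * s \<le> of_int (N K) * t" using st by (simp add: less_imp_le)
  have "path_upto K t x - path_upto K s x = (t - s) * poly (pderiv (cell_cdf K r)) x"
    using order_trans[OF st(1) le] order_trans[OF le st(3)] st r by (intro path_upto_affine[of a]) simp_all
  also have "\<dots> \<ge> 0" using st cell_cdf_is_cdf[of K r] assms by (auto simp: is_cdf_def)
  finally show "path_upto K s x \<le> path_upto K t x" by simp
qed

lemma path_mono:
  assumes "s \<le> t" "x \<in> {0..1}"
  shows "path s x \<le> path t x"
proof -
  have "(\<lambda>K. path_upto K u x) \<longlonglongrightarrow> path u x" for u
    unfolding path_upto_def path_def wave_def using summable_LIMSEQ[OF wave_summable[OF assms(2), of u 1]]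
    by (intro tendsto_intros) simp
  then show ?thesis using path_upto_mono[OF assms] by (meson LIMSEQ_le)
qed

lemma path_isometric: "isometric_embedding_unit (\<lambda>t. abs_L1 (path t))"
proof -
  have *: "norm (abs_L1 (path t) - abs_L1 (path s)) = t - s" if "s \<le> t" for s t
  proof -
    have "norm (abs_L1 (path t) - abs_L1 (path s)) = integral {0..1} (\<lambda>x. \<bar>path t x - path s x\<bar>)"
      using path_continuous by (simp add: abs_L1_diff norm_abs_L1 continuous_intros)
    also have "\<dots> = integral {0..1} (\<lambda>x. path t x - path s x)"
      using path_mono[OF that] by (intro integral_cong) auto
    also have "\<dots> = t - s"
      by (intro integral_unique has_integral_diff path_integral)
    finally show ?thesis .
  qed
  show ?thesis
    unfolding isometric_embedding_unit_def
  proof (intro ballI)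
    fix s t :: real
    show "norm (abs_L1 (path t) - abs_L1 (path s)) = \<bar>t - s\<bar>"
      using *[of s t] *[of t s] by (cases "s \<le> t") (auto simp: norm_minus_commute)
  qed
qed

section \<open>Difference quotients over cells and nondifferentiability\<close>

lemma path_grid:
  assumes "of_int (N K) * t = of_int a"
  shows "path t x = path_upto K t x"
proof -
  have "wave 1 t x = (\<Sum>k<K. height k t * poly ((pderiv ^^ 1) (wobble k t)) x)"
    unfolding wave_def using height_grid[OF assms] by (intro suminf_finite) auto
  then show ?thesis by (simp add: path_def path_upto_def)
qed

text \<open>All corrections from level \<open>K\<close> on vanish at both ends of the cell, so the
  quotient of the full path over the cell is exactly the density of level \<open>K\<close>.\<close>

lemma path_cell_increment:
  assumes "of_int (N K) * s = of_int a" "of_int (N K) * t = of_int a + 1"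
    and "of_int a \<le> of_int (N K) * r" "of_int (N K) * r < of_int a + 1"
  shows "abs_L1 (path t) - abs_L1 (path s) = (t - s) *\<^sub>R abs_L1 (poly (pderiv (cell_cdf K r)))"
proof -
  have "path t x - path s x = (t - s) * poly (pderiv (cell_cdf K r)) x" for x
    using path_upto_affine[of a K r s t x] path_grid[of K s a x] path_grid[of K t "a + 1" x] assms by simp
  then show ?thesis
    using path_continuous by (simp add: abs_L1_diff abs_L1_scaleR continuous_intros)
qed

text \<open>A level-\<open>K\<close> cell and one of its subcells of level \<open>Suc K\<close> both
  contain \<open>t\<close>. At a derivative \<open>D\<close> both quotients would be close to
  \<open>D\<close>, yet they are the densities of a distribution function and of one of its
  splittings, which stay a fixed distance apart.\<close>

lemma path_not_differentiable: "\<not> differentiability_point (\<lambda>t. abs_L1 (path t)) t"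
proof
  assume "differentiability_point (\<lambda>t. abs_L1 (path t)) t"
  then obtain D where t: "t \<in> {0..1}"
    and D: "((\<lambda>t. abs_L1 (path t)) has_vector_derivative D) (at t within {0..1})"
    unfolding differentiability_point_def by blast
  \<comment> \<open>Two densities within 1/8 of \<open>D\<close> are within 1/4 of each other, which
    is less than the separation 1/3.\<close>
  from straddled_difference_quotient[OF D, of "1/8"]
  obtain d where d: "d > 0" and quot: "\<And>a b. 0 \<le> a \<Longrightarrow> a \<le> t \<Longrightarrow> t \<le> b \<Longrightarrow> b \<le> 1 \<Longrightarrow> b - a < d \<Longrightarrow>
      norm (abs_L1 (path b) - abs_L1 (path a) - (b - a) *\<^sub>R D) \<le> 1/8 * (b - a)"
    by auto
  obtain K where "(1/2) ^ K < d" using d real_arch_pow_inv[of d "1/2"] by auto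
  then have K: "1 / of_int (N k) < d" if "K \<le> k" for k
  proof -
    have "(2::int) ^ K \<le> N k" using N_ge[of k] that by (meson one_le_numeral order_trans power_increasing)
    then have "(2::real) ^ K \<le> of_int (N k)" by (metis of_int_le_iff of_int_numeral of_int_power)
    then have "1 / of_int (N k) \<le> 1 / (2::real) ^ K" by (intro divide_left_mono) auto
    then show ?thesis using \<open>(1/2) ^ K < d\<close> by (simp add: power_one_over)
  qed
  have cell_density: "norm (abs_L1 (poly (pderiv (cell_cdf k r))) - D) \<le> 1/8"
    if "K \<le> k" "0 \<le> a" "a + 1 \<le> N k" "of_int a \<le> of_int (N k) * t" "of_int (N k) * t \<le> of_int a + 1"
      "of_int a \<le> of_int (N k) * r" "of_int (N k) * r < of_int a + 1" for k a r
  proof -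
    define n where "n = real_of_int (N k)"
    have n: "0 < n" by (simp add: n_def)
    define u where "u = real_of_int a / n"
    define v where "v = (real_of_int a + 1) / n"
    have uv: "v - u = 1 / n" "n * u = of_int a" "n * v = of_int a + 1"
      using n by (simp_all add: u_def v_def field_simps)
    have "real_of_int (a + 1) \<le> n" using that(3) unfolding n_def by (simp only: of_int_le_iff)
    then have ends: "0 \<le> u" "u \<le> t" "t \<le> v" "v \<le> 1"
      using n that by (simp_all add: u_def v_def n_def field_simps)
    have "abs_L1 (path v) - abs_L1 (path u) = (v - u) *\<^sub>R abs_L1 (poly (pderiv (cell_cdf k r)))"
      using uv that by (intro path_cell_increment[of k u a v r]) (auto simp: n_def)
    then have "norm ((v - u) *\<^sub>R (abs_L1 (poly (pderiv (cell_cdf k r))) - D)) \<le> 1/8 * (v - u)"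
      using quot[OF ends] K[OF that(1)] uv by (simp add: n_def scaleR_diff_right)
    then have "norm (abs_L1 (poly (pderiv (cell_cdf k r))) - D) / n \<le> (1/8) / n"
      using n unfolding norm_scaleR uv(1) by simp
    then show ?thesis using n by (simp only: divide_le_cancel)
  qed
  have "\<exists>a\<ge>0. a < N K \<and> of_int a \<le> of_int (N K) * t \<and> of_int (N K) * t \<le> of_int a + 1"
    using t by (intro exists_subcell) (simp_all add: mult_left_le)
  then obtain a where a: "0 \<le> a" "a < N K" "of_int a \<le> of_int (N K) * t" "of_int (N K) * t \<le> of_int a + 1"
    by blast
  obtain c where c: "c \<ge> 1" "N (Suc K) = 2 * c * N K" using N_Suc by blast
  have "\<exists>a'\<ge>2 * c * a. a' < 2 * c * (a + 1) \<and>
      of_int a' \<le> of_int (N (Suc K)) * t \<and> of_int (N (Suc K)) * t \<le> of_int a' + 1"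
  proof (rule exists_subcell)
    have "of_int (2 * c) * real_of_int a \<le> of_int (2 * c) * (of_int (N K) * t)"
      "of_int (2 * c) * (of_int (N K) * t) \<le> of_int (2 * c) * (real_of_int a + 1)"
      using a c by (intro mult_left_mono; simp)+
    then show "of_int (2 * c * a) \<le> of_int (N (Suc K)) * t" "of_int (N (Suc K)) * t \<le> of_int (2 * c * (a + 1))"
      by (simp_all add: c(2))
    show "2 * c * a < 2 * c * (a + 1)" using c by simp
  qed
  then obtain a' where a': "2 * c * a \<le> a'" "a' < 2 * c * (a + 1)"
    "of_int a' \<le> of_int (N (Suc K)) * t" "of_int (N (Suc K)) * t \<le> of_int a' + 1"
    by blast
  \<comment> \<open>The left end of the subcell lies in the half-open cells of both levels, so one
    \<open>r\<close> selects both densities.\<close>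
  define r where "r = real_of_int a' / of_int (N (Suc K))"
  have r: "of_int (N (Suc K)) * r = of_int a'" by (simp add: r_def)
  have rK: "of_int a \<le> of_int (N K) * r" "of_int (N K) * r < of_int a + 1"
    using subcell(1,3)[of "2 * c" a a' "of_int (N K) * r"] a' r c by (auto simp: mult.assoc)
  have "0 \<le> 2 * c * a" "2 * c * (a + 1) \<le> N (Suc K)"
    using a c by (auto intro!: mult_left_mono)
  then have "0 \<le> a'" "a' + 1 \<le> N (Suc K)"
    using a' by linarith+
  then have 1: "norm (abs_L1 (poly (pderiv (cell_cdf (Suc K) r))) - D) \<le> 1/8"
    using a' r by (intro cell_density[of _ a']) auto
  have 2: "norm (abs_L1 (poly (pderiv (cell_cdf K r))) - D) \<le> 1/8"
    using a rK by (intro cell_density[of _ a]) auto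
  have "1/3 \<le> integral {0..1} (\<lambda>x. \<bar>poly (pderiv ((cell_cdf K r)\<^sup>2 - cell_cdf K r)) x\<bar>)"
    by (intro cdf_split_separation cell_cdf_is_cdf)
  \<comment> \<open>The parity of the subcell only decides the sign of the difference.\<close>
  also have "\<dots> = integral {0..1} (\<lambda>x. \<bar>poly (pderiv (cell_cdf (Suc K) r)) x - poly (pderiv (cell_cdf K r)) x\<bar>)"
    by (intro integral_cong) (simp add: cdf_pderivs abs_minus_commute algebra_simps)
  also have "\<dots> = norm (abs_L1 (poly (pderiv (cell_cdf (Suc K) r))) - abs_L1 (poly (pderiv (cell_cdf K r))))"
    by (simp add: abs_L1_diff norm_abs_L1 continuous_intros del: cell_cdf.simps)
  also have "\<dots> \<le> 1/8 + 1/8"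
    using norm_triangle_ineq4[of "abs_L1 (poly (pderiv (cell_cdf (Suc K) r))) - D" "abs_L1 (poly (pderiv (cell_cdf K r))) - D"] 1 2
    by (simp del: cell_cdf.simps)
  finally show False by simp
qed

end

section \<open>Choice of the scales and conclusion\<close>

text \<open>Each polynomial admits one constant for all bounds of its level, and a level has
  finitely many polynomials, so a common integer constant exists.\<close>

lemma scales_exist:
  assumes "\<And>m. w m > 0"
  obtains N where "scales N w"
proof -
  let ?bd = "\<lambda>k M C. (\<forall>m. \<forall>x\<in>{0..1}. \<bar>poly ((pderiv ^^ m) (M\<^sup>2 - M)) x\<bar> \<le> C * (w m * (1/2) ^ Suc k))
      \<and> (\<forall>z. norm z \<le> real k \<longrightarrow> norm (cpoly (pderiv (M\<^sup>2 - M)) z) \<le> C * (1/2) ^ k)"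
  have mono: "?bd k M C'" if "?bd k M C" "C \<le> C'" for k M C C'
  proof -
    have "C * (w m * (1/2) ^ Suc k) \<le> C' * (w m * (1/2) ^ Suc k)" for m
      using that(2) assms[of m] by (intro mult_right_mono) auto
    moreover have "C * (1/2) ^ k \<le> C' * (1/2) ^ k"
      using that(2) by (intro mult_right_mono) auto
    ultimately show ?thesis using that(1) by (blast intro: order_trans)
  qed
  have one: "\<exists>C. ?bd k M C" for k M
  proof -
    obtain A where A: "\<And>m x. x \<in> {0..1} \<Longrightarrow> \<bar>poly ((pderiv ^^ m) (M\<^sup>2 - M)) x\<bar> \<le> A * (w m * (1/2) ^ Suc k)"
    proof -
      have "0 < w m * (1/2) ^ Suc k" for m using assms by simp
      from higher_pderiv_weighted_bound[where w = "\<lambda>m. w m * (1/2) ^ Suc k", OF this, of "M\<^sup>2 - M"]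
      show ?thesis using that by blast
    qed
    obtain B where B: "\<And>z. norm z \<le> real k \<Longrightarrow> norm (cpoly (pderiv (M\<^sup>2 - M)) z) \<le> B"
      using cpoly_bound by blast
    \<comment> \<open>The factor \<open>2 ^ k\<close> at \<open>B\<close> compensates the
      \<open>(1/2) ^ k\<close> in the complex bound.\<close>
    have "A * (w m * (1/2) ^ Suc k) \<le> max A (B * 2 ^ k) * (w m * (1/2) ^ Suc k)" for m
      using assms[of m] by (intro mult_right_mono) auto
    moreover have "B \<le> max A (B * 2 ^ k) * (1/2) ^ k"
      using mult_right_mono[of "B * 2 ^ k" "max A (B * 2 ^ k)" "(1/2) ^ k"] by (simp add: power_one_over)
    ultimately have "?bd k M (max A (B * 2 ^ k))"
      using A B by (blast intro: order_trans)
    then show ?thesis by blast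
  qed
  have "\<exists>C::int. C \<ge> 1 \<and> (\<forall>M\<in>cdfs k. ?bd k M (of_int C))" for k
  proof -
    have "\<forall>M. \<exists>C. ?bd k M C" using one by (rule allI)
    from choice[OF this] obtain B where "\<forall>M. ?bd k M (B M)" by (rule exE)
    then have B: "?bd k M (B M)" for M by (rule spec)
    define C where "C = max 1 \<lceil>Max (insert 1 (B ` cdfs k))\<rceil>"
    have "B M \<le> of_int C" if "M \<in> cdfs k" for M
    proof -
      have "B M \<le> Max (insert 1 (B ` cdfs k))" using that finite_cdfs by (intro Max_ge) auto
      also have "\<dots> \<le> of_int C" unfolding C_def by linarith
      finally show ?thesis .
    qed
    then have "\<forall>M\<in>cdfs k. ?bd k M (of_int C)" by (intro ballI mono[OF B])
    then show ?thesis by (intro exI[of _ C]) (auto simp: C_def)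
  qed
  then obtain C where C: "\<And>k. C k \<ge> (1::int)"
    "\<And>k M m x. M \<in> cdfs k \<Longrightarrow> x \<in> {0..1} \<Longrightarrow> \<bar>poly ((pderiv ^^ m) (M\<^sup>2 - M)) x\<bar> \<le> of_int (C k) * (w m * (1/2) ^ Suc k)"
    "\<And>k M z. M \<in> cdfs k \<Longrightarrow> norm z \<le> real k \<Longrightarrow> norm (cpoly (pderiv (M\<^sup>2 - M)) z) \<le> of_int (C k) * (1/2) ^ k"
    by metis
  \<comment> \<open>The factor 2 makes the ratio even, and \<open>C k\<close> makes
    \<open>N (Suc k)\<close> at least the constant required at level \<open>k\<close>.\<close>
  define N where "N = rec_nat (1::int) (\<lambda>k n. 2 * C k * n)"
  have N: "N 0 = 1" "N (Suc k) = 2 * C k * N k" for k by (simp_all add: N_def)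
  have pos: "N k \<ge> 1" for k
  proof (induction k)
    case (Suc k)
    have "1 * 1 \<le> C k * N k" using C(1)[of k] Suc by (intro mult_mono) auto
    then show ?case by (simp add: N)
  qed (simp add: N)
  have CN: "C k \<le> N (Suc k)" for k
    using mult_left_mono[OF pos[of k], of "C k"] C(1)[of k] by (simp add: N)
  show ?thesis
  proof (rule that[of N], unfold_locales)
    show "N 0 = 1" by fact
    show "\<exists>c\<ge>1. N (Suc k) = 2 * c * N k" for k using N C(1) by blast
    fix M k
    assume M: "M \<in> cdfs k"
    show "\<bar>poly ((pderiv ^^ m) (M\<^sup>2 - M)) x\<bar> \<le> of_int (N (Suc k)) * (w m * (1/2) ^ Suc k)"
      if "x \<in> {0..1}" for m x
      using CN[of k] assms[of m] by (intro order_trans[OF C(2)[OF M that]] mult_right_mono) auto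
    show "norm (cpoly (pderiv (M\<^sup>2 - M)) z) \<le> of_int (N (Suc k)) * (1/2) ^ k" if "norm z \<le> real k" for z
      using CN[of k] by (intro order_trans[OF C(3)[OF M that]] mult_right_mono) auto
  qed
qed

theorem theorem1p1:
  fixes \<omega> :: "nat \<Rightarrow> real"
  assumes "\<And>m. m \<ge> 1 \<Longrightarrow> \<omega> m > 0"
  shows "\<exists>F :: real \<Rightarrow> L1. isometric_embedding_unit F
    \<and> (\<forall>t\<in>{0..1}. \<exists>f. represents f (F t)
         \<and> smooth_on_unit f
         \<and> (\<forall>m\<ge>1. \<forall>x\<in>{0..1}. \<bar>unit_deriv m f x\<bar> \<le> \<omega> m)
         \<and> has_entire_extension f)
    \<and> (\<forall>t\<in>{0..1}. \<not> differentiability_point F t)"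
proof -
  \<comment> \<open>index shifted by one, since \<open>wave\<close> starts from a primitive\<close>
  define w where "w m = (if m \<le> 1 then 1 else \<omega> (m - 1))" for m
  have "w m > 0" for m
    using assms by (simp add: w_def)
  then obtain N where "scales N w"
    by (rule scales_exist)
  then interpret scales N w .
  have "represents (path t) (abs_L1 (path t))" for t
    using path_continuous by (simp add: represents_def continuous_imp_integrable_real)
  \<comment> \<open>Here \<open>w (Suc m)\<close> is \<open>\<omega> m\<close>. The value 1 of
    \<open>w\<close> at 0 and 1 controls the primitive and the oscillating part itself, on which no
    bound is prescribed.\<close>
  moreover have "\<bar>unit_deriv m (path t) x\<bar> \<le> \<omega> m" if "m \<ge> 1" "x \<in> {0..1}" for m t x
    using wave_bound[OF that(2), of "Suc m" t] that by (simp add: path_deriv(1) w_def)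
  ultimately show ?thesis
    using path_isometric smooth_path path_entire path_not_differentiable by blast
qed

end
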